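(* Let $A$ be a modal formula. If $\mathbf{IL}\vdash A$, then $F\models A$ for every $\mathbf{IL}_{\mathrm{set}}$-frame $F$.
   Context: Modal formulas are built from $\bot$ and countably many propositional variables using $\rightarrow$, the unary modality $\Box$ and the binary modality $\rhd$; other boolean connectives are defined as usual and $\Diamond A:=\neg\Box\neg A$. $\mathbf{IL}$ is the smallest set of formulas containing all propositional tautologies and all instances of the schemata below and closed under Modus Ponens and Necessitation (from $A$ infer $\Box A$); $\mathbf{IL}\vdash A$ means $A\in\mathbf{IL}$: L1: $\Box(A\rightarrow B)\rightarrow(\Box A\rightarrow\Box B)$; L2: $\Box A\rightarrow\Box\Box A$; L3: $\Box(\Box A\rightarrow A)\rightarrow\Box A$; J1: $\Box(A\rightarrow B)\rightarrow (A\rhd B)$; J2: $(A\rhd B)\wedge(B\rhd C)\rightarrow (A\rhd C)$; J3: $(A\rhd C)\wedge(B\rhd C)\rightarrow ((A\vee B)\rhd C)$; J4: $(A\rhd B)\rightarrow(\Diamond A\rightarrow\Diamond B)$; J5: $\Diamond A\rhd A$. An $\mathbf{IL}_{\mathrm{set}}$-frame is a structure $\langle W,R,S\rangle$ where $W$ is a non-empty set, $R$ is a transitive and conversely well-founded binary relation on $W$ (every non-empty subset of $W$ has an $R$-maximal element), and $S\subseteq W\times W\times(\mathcal P(W)\setminus\{\emptyset\})$ satisfies, writing $yS_xY$ for $(x,y,Y)\in S$: (a) if $xS_wY$ then $wRx$ and $wRy$ for all $y\in Y$; (b) $wRx$ implies $xS_w\{x\}$; (c) if $xS_wY$, then for all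 $y\in Y$ and all $Z$: if $y\notin Z$ and $yS_wZ$ then $xS_wZ$; (d) $wRx$ and $xRy$ imply $xS_w\{y\}$. An $\mathbf{IL}_{\mathrm{set}}$-model based on such a frame is obtained by adding a relation $\Vdash$ between worlds and formulas that commutes with boolean connectives and satisfies: $w\Vdash\Box A$ iff $x\Vdash A$ for all $x$ with $wRx$; $w\Vdash A\rhd B$ iff for all $x$ with $wRx$ and $x\Vdash A$ there is $Y$ with $xS_wY$ and $y\Vdash B$ for all $y\in Y$. $F\models A$ ($A$ is valid on $F$) means that $w\Vdash A$ for every world $w$ of every model based on $F$. *)

theory Defs
  imports Main
begin

datatype fm =
    Var nat
  | Bot ("\<^bold>\<bottom>")
  | Imp fm fm (infixr "\<^bold>\<rightarrow>" 55)
  | Box fm ("\<box> _" [80] 80)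
  | Rhd fm fm (infix "\<rhd>" 70)

abbreviation Neg :: "fm \<Rightarrow> fm" ("\<^bold>\<not> _" [80] 80)
  where "\<^bold>\<not> A \<equiv> A \<^bold>\<rightarrow> \<^bold>\<bottom>"

abbreviation Disj :: "fm \<Rightarrow> fm \<Rightarrow> fm" (infixr "\<^bold>\<or>" 60)
  where "A \<^bold>\<or> B \<equiv> \<^bold>\<not> A \<^bold>\<rightarrow> B"

abbreviation Conj :: "fm \<Rightarrow> fm \<Rightarrow> fm" (infixr "\<^bold>\<and>" 65)
  where "A \<^bold>\<and> B \<equiv> \<^bold>\<not> (A \<^bold>\<rightarrow> \<^bold>\<not> B)"

abbreviation Dia :: "fm \<Rightarrow> fm" ("\<diamond> _" [80] 80)
  where "\<diamond> A \<equiv> \<^bold>\<not> (\<box> (\<^bold>\<not> A))"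

text \<open>A modal formula is a propositional tautology if it is true under every truth assignment
  to its variables and to its maximal subformulas of the form \<open>\<box> A\<close> or \<open>A \<rhd> B\<close>, which are treated
  as atoms. In \<open>peval v\<close>, only the values of \<open>v\<close> on these formulas and on variables matter.\<close>

primrec peval :: "(fm \<Rightarrow> bool) \<Rightarrow> fm \<Rightarrow> bool" where
  "peval v (Var p) = v (Var p)"
| "peval v \<^bold>\<bottom> = False"
| "peval v (A \<^bold>\<rightarrow> B) = (peval v A \<longrightarrow> peval v B)"
| "peval v (\<box> A) = v (\<box> A)"
| "peval v (A \<rhd> B) = v (A \<rhd> B)"

definition tautology :: "fm \<Rightarrow> bool" where
  "tautology A \<longleftrightarrow> (\<forall>v. peval v A)"

inductive_set IL :: "fm set" where
  Taut: "tautology A \<Longrightarrow> A \<in> IL"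
| L1: "\<box> (A \<^bold>\<rightarrow> B) \<^bold>\<rightarrow> (\<box> A \<^bold>\<rightarrow> \<box> B) \<in> IL"
| L2: "\<box> A \<^bold>\<rightarrow> \<box> (\<box> A) \<in> IL"
| L3: "\<box> (\<box> A \<^bold>\<rightarrow> A) \<^bold>\<rightarrow> \<box> A \<in> IL"
| J1: "\<box> (A \<^bold>\<rightarrow> B) \<^bold>\<rightarrow> (A \<rhd> B) \<in> IL"
| J2: "(A \<rhd> B) \<^bold>\<and> (B \<rhd> C) \<^bold>\<rightarrow> (A \<rhd> C) \<in> IL"
| J3: "(A \<rhd> C) \<^bold>\<and> (B \<rhd> C) \<^bold>\<rightarrow> ((A \<^bold>\<or> B) \<rhd> C) \<in> IL"
| J4: "(A \<rhd> B) \<^bold>\<rightarrow> (\<diamond> A \<^bold>\<rightarrow> \<diamond> B) \<in> IL"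
| J5: "(\<diamond> A) \<rhd> A \<in> IL"
| MP: "A \<in> IL \<Longrightarrow> A \<^bold>\<rightarrow> B \<in> IL \<Longrightarrow> B \<in> IL"
| Nec: "A \<in> IL \<Longrightarrow> \<box> A \<in> IL"

text \<open>\<open>(w, x, Y) \<in> S\<close> stands for \<open>x S\<^sub>w Y\<close>.\<close>

locale ILset_frame =
  fixes W :: "'w set"
    and R :: "('w \<times> 'w) set"
    and S :: "('w \<times> 'w \<times> 'w set) set"
  assumes W_nonempty: "W \<noteq> {}"
    and R_subset: "R \<subseteq> W \<times> W"
    and R_trans: "trans R"
    and R_conv_wf: "\<And>X. X \<subseteq> W \<Longrightarrow> X \<noteq> {} \<Longrightarrow> \<exists>m\<in>X. \<forall>x\<in>X. (m, x) \<notin> R"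
    and S_subset: "S \<subseteq> W \<times> W \<times> (Pow W - {{}})"
    and S_succ: "\<And>w x Y. (w, x, Y) \<in> S \<Longrightarrow> (w, x) \<in> R \<and> (\<forall>y\<in>Y. (w, y) \<in> R)"
    and S_quasi_refl: "\<And>w x. (w, x) \<in> R \<Longrightarrow> (w, x, {x}) \<in> S"
    and S_quasi_trans: "\<And>w x y Y Z. (w, x, Y) \<in> S \<Longrightarrow> y \<in> Y \<Longrightarrow> y \<notin> Z \<Longrightarrow>
          (w, y, Z) \<in> S \<Longrightarrow> (w, x, Z) \<in> S"
    and S_R: "\<And>w x y. (w, x) \<in> R \<Longrightarrow> (x, y) \<in> R \<Longrightarrow> (w, x, {y}) \<in> S"

text \<open>The values of \<open>forces\<close> outside \<open>W\<close> are unconstrained and irrelevant.\<close>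

locale ILset_model = ILset_frame W R S
  for W :: "'w set" and R :: "('w \<times> 'w) set" and S :: "('w \<times> 'w \<times> 'w set) set" +
  fixes forces :: "'w \<Rightarrow> fm \<Rightarrow> bool"  (infix "\<tturnstile>" 50)
  assumes forces_Bot: "\<And>w. w \<in> W \<Longrightarrow> \<not> w \<tturnstile> \<^bold>\<bottom>"
    and forces_Imp: "\<And>w A B. w \<in> W \<Longrightarrow> w \<tturnstile> A \<^bold>\<rightarrow> B \<longleftrightarrow> (w \<tturnstile> A \<longrightarrow> w \<tturnstile> B)"
    and forces_Box: "\<And>w A. w \<in> W \<Longrightarrow> w \<tturnstile> \<box> A \<longleftrightarrow> (\<forall>x. (w, x) \<in> R \<longrightarrow> x \<tturnstile> A)"
    and forces_Rhd: "\<And>w A B. w \<in> W \<Longrightarrow> w \<tturnstile> A \<rhd> B \<longleftrightarrow>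
          (\<forall>x. (w, x) \<in> R \<and> x \<tturnstile> A \<longrightarrow> (\<exists>Y. (w, x, Y) \<in> S \<and> (\<forall>y\<in>Y. y \<tturnstile> B)))"

definition valid_on ::
    "'w set \<Rightarrow> ('w \<times> 'w) set \<Rightarrow> ('w \<times> 'w \<times> 'w set) set \<Rightarrow> fm \<Rightarrow> bool" where
  "valid_on W R S A \<longleftrightarrow> (\<forall>forces. ILset_model W R S forces \<longrightarrow> (\<forall>w\<in>W. forces w A))"

end

theory Submission imports Defs begin

text \<open>Soundness by induction on the derivation. The delicate axiom is J2: given \<open>x S\<^sub>w Y\<close> with \<open>Y\<close>
  forcing \<open>B\<close>, either all of \<open>Y\<close> already forces \<open>C\<close>, or some \<open>y \<in> Y\<close> does not; in the latter case
  \<open>y S\<^sub>w Z\<close> for some \<open>Z\<close> forcing \<open>C\<close>, so \<open>y \<notin> Z\<close> and the restricted transitivity yields \<open>x S\<^sub>w Z\<close>.\<close>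

context ILset_model
begin

lemma R_in_W: "(w, x) \<in> R \<Longrightarrow> w \<in> W" "(w, x) \<in> R \<Longrightarrow> x \<in> W"
  using R_subset by blast+

lemma forces_Disj: "w \<in> W \<Longrightarrow> w \<tturnstile> A \<^bold>\<or> B \<longleftrightarrow> w \<tturnstile> A \<or> w \<tturnstile> B"
  by (auto simp: forces_Imp forces_Bot)

lemma forces_Conj: "w \<in> W \<Longrightarrow> w \<tturnstile> A \<^bold>\<and> B \<longleftrightarrow> w \<tturnstile> A \<and> w \<tturnstile> B"
  by (auto simp: forces_Imp forces_Bot)

lemma forces_Dia: "w \<in> W \<Longrightarrow> w \<tturnstile> \<diamond> A \<longleftrightarrow> (\<exists>x. (w, x) \<in> R \<and> x \<tturnstile> A)"
  using R_in_W by (simp add: forces_Imp forces_Bot forces_Box)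

lemma forces_RhdI:
  assumes "w \<in> W"
    and "\<And>x. (w, x) \<in> R \<Longrightarrow> x \<tturnstile> A \<Longrightarrow> \<exists>Y. (w, x, Y) \<in> S \<and> (\<forall>y\<in>Y. y \<tturnstile> B)"
  shows "w \<tturnstile> A \<rhd> B"
  using assms by (simp add: forces_Rhd)

lemma forces_RhdE:
  assumes "w \<tturnstile> A \<rhd> B" "(w, x) \<in> R" "x \<tturnstile> A"
  obtains Y where "(w, x, Y) \<in> S" "\<And>y. y \<in> Y \<Longrightarrow> y \<tturnstile> B"
  using assms forces_Rhd R_in_W by blast

text \<open>Forcing at a fixed world commutes with the boolean connectives, so it is itself a truth
  assignment on the modal atoms. Tautologies are thereby forced at every world.\<close>

lemma forces_eq_peval: "w \<in> W \<Longrightarrow> w \<tturnstile> A \<longleftrightarrow> peval (\<lambda>B. w \<tturnstile> B) A"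
  by (induction A) (auto simp: forces_Imp forces_Bot)

lemma forces_L2:
  assumes "w \<in> W" shows "w \<tturnstile> \<box> A \<^bold>\<rightarrow> \<box> (\<box> A)"
  using assms transD[OF R_trans] forces_Box forces_Imp R_in_W by meson

text \<open>Converse well-foundedness supplies an \<open>R\<close>-maximal counterexample to
  \<open>A\<close> among the successors of \<open>w\<close>; there Loeb's hypothesis fails.\<close>

lemma forces_L3:
  assumes w: "w \<in> W" shows "w \<tturnstile> \<box> (\<box> A \<^bold>\<rightarrow> A) \<^bold>\<rightarrow> \<box> A"
proof -
  have "x \<tturnstile> A" if hyp: "w \<tturnstile> \<box> (\<box> A \<^bold>\<rightarrow> A)" and x: "(w, x) \<in> R" for x
  proof (rule ccontr)
    assume "\<not> x \<tturnstile> A"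
    define X where "X = {y. (w, y) \<in> R \<and> \<not> y \<tturnstile> A}"
    have "X \<subseteq> W" "X \<noteq> {}"
      using x \<open>\<not> x \<tturnstile> A\<close> R_in_W by (auto simp: X_def)
    then obtain m where m: "m \<in> X" "\<forall>y\<in>X. (m, y) \<notin> R"
      using R_conv_wf by blast
    have wm: "(w, m) \<in> R" "\<not> m \<tturnstile> A"
      using m(1) by (auto simp: X_def)
    \<comment> \<open>By transitivity a successor of \<open>m\<close> is a successor of
      \<open>w\<close>; by maximality it lies outside \<open>X\<close>, hence forces
      \<open>A\<close>.\<close>
    have "m \<tturnstile> \<box> A"
      using m(2) transD[OF R_trans wm(1)] forces_Box[OF R_in_W(2)[OF wm(1)]]
      by (auto simp: X_def)
    moreover have "m \<tturnstile> \<box> A \<^bold>\<rightarrow> A"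
      using hyp w wm(1) forces_Box by blast
    ultimately show False
      using wm forces_Imp R_in_W by blast
  qed
  then show ?thesis
    using w forces_Imp forces_Box by blast
qed

text \<open>A successor forcing \<open>A\<close> already forces \<open>B\<close>, so
  quasi-reflexivity lets its own singleton serve as the witness.\<close>

lemma forces_J1:
  assumes "w \<in> W" shows "w \<tturnstile> \<box> (A \<^bold>\<rightarrow> B) \<^bold>\<rightarrow> (A \<rhd> B)"
proof -
  have "w \<tturnstile> A \<rhd> B" if "w \<tturnstile> \<box> (A \<^bold>\<rightarrow> B)"
  proof (rule forces_RhdI)
    fix x assume x: "(w, x) \<in> R" "x \<tturnstile> A"
    then have "x \<tturnstile> B"
      using that assms forces_Box forces_Imp R_in_W by blast
    then show "\<exists>Y. (w, x, Y) \<in> S \<and> (\<forall>y\<in>Y. y \<tturnstile> B)"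
      using S_quasi_refl[OF x(1)] by blast
  qed fact
  then show ?thesis
    using assms forces_Imp by blast
qed

lemma forces_Rhd_trans:
  assumes AB: "w \<tturnstile> A \<rhd> B" and BC: "w \<tturnstile> B \<rhd> C" and "w \<in> W"
  shows "w \<tturnstile> A \<rhd> C"
proof (rule forces_RhdI)
  fix x assume x: "(w, x) \<in> R" "x \<tturnstile> A"
  obtain Y where Y: "(w, x, Y) \<in> S" "\<And>y. y \<in> Y \<Longrightarrow> y \<tturnstile> B"
    using forces_RhdE[OF AB x] by blast
  show "\<exists>Z. (w, x, Z) \<in> S \<and> (\<forall>z\<in>Z. z \<tturnstile> C)"
  proof (cases "\<forall>y\<in>Y. y \<tturnstile> C")
    case True
    with Y(1) show ?thesis by blast
  next
    case False
    then obtain y where y: "y \<in> Y" "\<not> y \<tturnstile> C" by blast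
    have wy: "(w, y) \<in> R"
      using S_succ[OF Y(1)] y(1) by blast
    obtain Z where Z: "(w, y, Z) \<in> S" "\<And>z. z \<in> Z \<Longrightarrow> z \<tturnstile> C"
      using forces_RhdE[OF BC wy Y(2)[OF y(1)]] by blast
    have "y \<notin> Z"
      using y(2) Z(2) by blast
    then have "(w, x, Z) \<in> S"
      using S_quasi_trans Y(1) y(1) Z(1) by blast
    then show ?thesis
      using Z(2) by blast
  qed
qed fact

text \<open>Whichever disjunct holds at the successor, the set supplied by the corresponding
  hypothesis works unchanged.\<close>

lemma forces_J3:
  assumes "w \<in> W" shows "w \<tturnstile> (A \<rhd> C) \<^bold>\<and> (B \<rhd> C) \<^bold>\<rightarrow> ((A \<^bold>\<or> B) \<rhd> C)"
proof -
  have "w \<tturnstile> (A \<^bold>\<or> B) \<rhd> C" if AC: "w \<tturnstile> A \<rhd> C" and BC: "w \<tturnstile> B \<rhd> C"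
  proof (rule forces_RhdI)
    fix x assume x: "(w, x) \<in> R" "x \<tturnstile> A \<^bold>\<or> B"
    then consider "x \<tturnstile> A" | "x \<tturnstile> B"
      using forces_Disj R_in_W by blast
    then show "\<exists>Y. (w, x, Y) \<in> S \<and> (\<forall>y\<in>Y. y \<tturnstile> C)"
      by cases (use AC BC x(1) forces_Rhd assms in blast)+
  qed fact
  then show ?thesis
    using assms forces_Conj forces_Imp by blast
qed

lemma forces_J4:
  assumes "w \<in> W" shows "w \<tturnstile> (A \<rhd> B) \<^bold>\<rightarrow> (\<diamond> A \<^bold>\<rightarrow> \<diamond> B)"
proof -
  have "w \<tturnstile> \<diamond> B" if AB: "w \<tturnstile> A \<rhd> B" and "w \<tturnstile> \<diamond> A"
  proof -
    obtain x where x: "(w, x) \<in> R" "x \<tturnstile> A"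
      using \<open>w \<tturnstile> \<diamond> A\<close> assms forces_Dia by blast
    obtain Y where Y: "(w, x, Y) \<in> S" "\<And>y. y \<in> Y \<Longrightarrow> y \<tturnstile> B"
      using forces_RhdE[OF AB x] by blast
    \<comment> \<open>An empty \<open>Y\<close> would force \<open>B\<close> vacuously; excluding it
      yields an actual successor of \<open>w\<close> forcing \<open>B\<close>.\<close>
    moreover have "Y \<noteq> {}"
      using Y(1) S_subset by blast
    ultimately show ?thesis
      using S_succ assms forces_Dia by blast
  qed
  then show ?thesis
    using assms forces_Imp by blast
qed

text \<open>If \<open>x\<close> sees a world \<open>y\<close> forcing \<open>A\<close>, then
  \<open>S_R\<close> gives the witness \<open>{y}\<close>.\<close>

lemma forces_J5:
  assumes "w \<in> W" shows "w \<tturnstile> (\<diamond> A) \<rhd> A"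
proof (rule forces_RhdI)
  fix x assume x: "(w, x) \<in> R" "x \<tturnstile> \<diamond> A"
  then obtain y where "(x, y) \<in> R" "y \<tturnstile> A"
    using forces_Dia R_in_W by blast
  then show "\<exists>Y. (w, x, Y) \<in> S \<and> (\<forall>y\<in>Y. y \<tturnstile> A)"
    using S_R[OF x(1)] by blast
qed fact

text \<open>The world stays arbitrary in the induction because necessitation needs the hypothesis at
  all successors of \<open>w\<close>.\<close>

theorem IL_sound: "A \<in> IL \<Longrightarrow> w \<in> W \<Longrightarrow> w \<tturnstile> A"
proof (induction A arbitrary: w rule: IL.induct)
  case (Taut A)
  then show ?case
    using forces_eq_peval unfolding tautology_def by blast
next
  case (L1 A B)
  then show ?case
    using forces_Imp forces_Box R_in_W(2) by meson
next
  case (J2 A B C)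
  then show ?case
    using forces_Rhd_trans[of w A B C] forces_Conj[of w] forces_Imp[of w] by meson
next
  case (MP A B)
  then show ?case
    using forces_Imp[of w A B] by blast
next
  case (Nec A)
  then show ?case
    using forces_Box[of w A] R_in_W(2) by blast
qed (fact forces_L2 forces_L3 forces_J1 forces_J3 forces_J4 forces_J5)+

end

theorem lemma3p3:
  fixes A :: fm
    and W :: "'w set" and R :: "('w \<times> 'w) set" and S :: "('w \<times> 'w \<times> 'w set) set"
  assumes "A \<in> IL"
    and "ILset_frame W R S"
  shows "valid_on W R S A"
  unfolding valid_on_def
  \<comment> \<open>Each relation \<open>forces\<close> considered by \<open>valid_on\<close> makes
    an \<open>ILset_model\<close>, so soundness inside that locale applies to it.\<close>
  using assms(1) ILset_model.IL_sound[of W R S _ A] by blast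

end
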